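(* Let $\mu$ be a finite positive Borel measure on the interval $[0,1)$. If $\alpha$ and $\beta$ satisfy one of the following conditions: (i) $\alpha=1$ and $\beta>2$; (ii) $0<\alpha<1$ and $\beta\ge 2$; (iii) $\alpha>1$ and $\beta\ge\alpha+1$; then $\mathcal{C}_\mu:\mathcal{B}^{\alpha}\to\mathcal{B}^{\beta}$ is bounded.
   Context: Let $\mathbb{D}=\{z\in\mathbb{C}:|z|<1\}$ and let $H(\mathbb{D})$ be the space of all analytic functions in $\mathbb{D}$. For $0<\alpha<\infty$, the Bloch-type space is $\mathcal{B}^{\alpha}=\{f\in H(\mathbb{D}):\|f\|_{\mathcal{B}^\alpha}=|f(0)|+\sup_{z\in\mathbb{D}}(1-|z|^2)^{\alpha}|f'(z)|<\infty\}$. For a finite positive Borel measure $\mu$ on $[0,1)$ and $f(z)=\sum_{n=0}^\infty a_nz^n\in H(\mathbb{D})$, the Cesàro-like operator is $$\mathcal{C}_\mu(f)(z)=\sum_{n=0}^\infty\left(\mu_n\sum_{k=0}^n a_k\right)z^n=\int_{[0,1)}\frac{f(tz)}{1-tz}\,d\mu(t),\quad z\in\mathbb{D},$$ where $\mu_n=\int_{[0,1)}t^n\,d\mu(t)$. *)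

theory Defs
  imports "HOL-Complex_Analysis.Complex_Analysis"
begin

text \<open>Analytic functions on the unit disc are total functions that are holomorphic on
  \<^term>\<open>ball (0::complex) 1\<close>; none of the notions below depends on the values outside the disc.\<close>

text \<open>The supremum is a real one, so this is the norm only where it is finite, that is,
  on \<open>bloch_space \<alpha>\<close>.\<close>

definition bloch_norm :: "real \<Rightarrow> (complex \<Rightarrow> complex) \<Rightarrow> real" where
  "bloch_norm \<alpha> f =
     norm (f 0) + (SUP z\<in>ball 0 1. (1 - (norm z)\<^sup>2) powr \<alpha> * norm (deriv f z))"

definition bloch_space :: "real \<Rightarrow> (complex \<Rightarrow> complex) set" where
  "bloch_space \<alpha> =
     {f. f holomorphic_on ball 0 1 \<and>
         bdd_above ((\<lambda>z. (1 - (norm z)\<^sup>2) powr \<alpha> * norm (deriv f z)) ` ball 0 1)}"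

definition taylor_coeff :: "(complex \<Rightarrow> complex) \<Rightarrow> nat \<Rightarrow> complex" where
  "taylor_coeff f n = (deriv ^^ n) f 0 / fact n"

definition moment :: "real measure \<Rightarrow> nat \<Rightarrow> real" where
  "moment \<mu> n = (LINT t|\<mu>. t ^ n)"

text \<open>For a finite measure on \<open>[0,1)\<close> and \<open>f\<close> analytic in the disc, the series converges at every
  point of the disc: its coefficients are those of \<open>f(z) / (1 - z)\<close> times a bounded sequence.\<close>

definition cesaro_like :: "real measure \<Rightarrow> (complex \<Rightarrow> complex) \<Rightarrow> complex \<Rightarrow> complex" where
  "cesaro_like \<mu> f z =
     (\<Sum>n. complex_of_real (moment \<mu> n) * (\<Sum>k\<le>n. taylor_coeff f k) * z ^ n)"

definition bloch_bounded ::
  "real \<Rightarrow> real \<Rightarrow> ((complex \<Rightarrow> complex) \<Rightarrow> complex \<Rightarrow> complex) \<Rightarrow> bool" where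
  "bloch_bounded \<alpha> \<beta> T \<longleftrightarrow>
     T ` bloch_space \<alpha> \<subseteq> bloch_space \<beta> \<and>
     (\<exists>C. \<forall>f\<in>bloch_space \<alpha>. bloch_norm \<beta> (T f) \<le> C * bloch_norm \<alpha> f)"

end

(* The n-th coefficient of the image F of f is moment n times the n-th coefficient of
   g z = f z / (1 - z), so F' z is the integral of t * g' (t * z), and |F' z| is at most the mass
   of the measure times the maximum of |g'| on |w| <= |z|. For alpha other than 1, integrating the
   bound on f' along a radius gives |f w| <= C (1 - |w|) powr - max 0 (alpha - 1), whence
   |g' w| <= C (1 - |w|) powr - beta. The logarithmic case alpha = 1 needs no separate estimate:
   the space for alpha = 1 embeds into the one for beta - 1 > 1. *)

theory Submission
  imports Defs
begin

section \<open>Power series in the disc and the coefficients of f(z) / (1 - z)\<close>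

lemma powser_summable_norm:
  fixes a :: "nat \<Rightarrow> complex"
  assumes "\<And>w. norm w < R \<Longrightarrow> summable (\<lambda>n. a n * w ^ n)" "norm z < R"
  shows "summable (\<lambda>n. norm (a n * z ^ n))"
proof -
  \<comment> \<open>Convergence at a point of modulus \<open>s\<close>, strictly between
    \<open>norm z\<close> and \<open>R\<close>, forces absolute convergence at
    \<open>z\<close>.\<close>
  obtain s where s: "norm z < s" "s < R" using assms(2) dense by blast
  have "norm (complex_of_real s) = s"
    using s norm_ge_zero[of z] unfolding norm_of_real by linarith
  then have "summable (\<lambda>n. a n * complex_of_real s ^ n)" using assms(1) s by simp
  from powser_insidea[OF this, of z] show ?thesis
    using s \<open>norm (complex_of_real s) = s\<close> by simp
qed

lemma taylor_sums:
  assumes "f holomorphic_on ball 0 1" "norm z < 1"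
  shows "(\<lambda>n. taylor_coeff f n * z ^ n) sums f z"
  using holomorphic_power_series[OF assms(1), of z] assms(2)
  by (simp add: taylor_coeff_def)

text \<open>This is the Cauchy product of the Taylor series of \<open>f\<close> with the geometric
  series: multiplying by 1 / (1 - z) turns coefficients into partial sums.\<close>

lemma partial_sum_coeffs_sums:
  assumes "f holomorphic_on ball 0 1" "norm z < 1"
  shows "(\<lambda>n. (\<Sum>k\<le>n. taylor_coeff f k) * z ^ n) sums (f z / (1 - z))"
proof -
  have s: "summable (\<lambda>n. norm (taylor_coeff f n * z ^ n))"
    using assms by (intro powser_summable_norm[where R = 1])
      (auto intro!: sums_summable taylor_sums)
  have g: "summable (\<lambda>n. norm (z ^ n))"
    using assms by (simp add: norm_power summable_geometric)
  have "(\<lambda>n. \<Sum>k\<le>n. taylor_coeff f k * z ^ k * z ^ (n - k)) sums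
      ((\<Sum>n. taylor_coeff f n * z ^ n) * (\<Sum>n. z ^ n))"
    by (rule Cauchy_product_sums[OF s g])
  also have "(\<Sum>n. taylor_coeff f n * z ^ n) = f z"
    using taylor_sums[OF assms] by (simp add: sums_iff)
  also have "(\<Sum>n. z ^ n) = 1 / (1 - z)"
    using assms(2) by (rule suminf_geometric)
  also have "(\<lambda>n. \<Sum>k\<le>n. taylor_coeff f k * z ^ k * z ^ (n - k)) =
      (\<lambda>n. (\<Sum>k\<le>n. taylor_coeff f k) * z ^ n)"
    by (auto simp: sum_distrib_right mult.assoc power_add[symmetric] intro!: ext sum.cong)
  finally show ?thesis by simp
qed

section \<open>Moments of the measure and the derivative of a moment-weighted power series\<close>

locale unit_interval_measure = finite_measure \<mu> for \<mu> :: "real measure" +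
  assumes sets_eq: "sets \<mu> = sets (restrict_space borel {0..<1})"
begin

abbreviation "mass \<equiv> measure \<mu> (space \<mu>)"

text \<open>The sigma-algebra determines the space, so \<open>sets_eq\<close> alone confines the
  measure to [0,1).\<close>

lemma space_eq: "space \<mu> = {0..<1}"
  using sets_eq_imp_space_eq[OF sets_eq] by (simp add: space_restrict_space)

lemma measurable_power: "(\<lambda>t. t ^ n) \<in> borel_measurable \<mu>"
  unfolding measurable_cong_sets[OF sets_eq refl]
  by (intro measurable_restrict_space1) simp

lemma integrable_power: "integrable \<mu> (\<lambda>t. t ^ n)"
  by (rule integrable_const_bound[where B = 1])
    (auto intro!: AE_I2 measurable_power simp: space_eq power_le_one)

lemma moment_nonneg: "0 \<le> moment \<mu> n"
  unfolding moment_def by (rule integral_nonneg_AE) (auto intro!: AE_I2 simp: space_eq)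

lemma moment_le: "moment \<mu> n \<le> mass"
proof -
  have "moment \<mu> n \<le> (LINT t|\<mu>. 1)"
    unfolding moment_def
    by (rule integral_mono_AE) (auto intro!: AE_I2 integrable_power simp: space_eq power_le_one)
  then show ?thesis by simp
qed

text \<open>The moments lie between 0 and the total mass, so the weighted series is dominated by a
  multiple of an absolutely convergent one.\<close>

lemma moment_powser_summable:
  fixes a :: "nat \<Rightarrow> complex"
  assumes "\<And>w. norm w < 1 \<Longrightarrow> summable (\<lambda>n. a n * w ^ n)" "norm z < 1"
  shows "summable (\<lambda>n. moment \<mu> n * a n * z ^ n)"
proof (rule summable_comparison_test')
  show "summable (\<lambda>n. mass * norm (a n * z ^ n))"
    by (intro summable_mult powser_summable_norm[where R = 1] assms)
  show "norm (moment \<mu> n * a n * z ^ n) \<le> mass * norm (a n * z ^ n)" for n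
    using moment_nonneg[of n] moment_le[of n]
    by (simp add: norm_mult mult.assoc mult_right_mono)
qed

text \<open>Differentiation shifts the index, so the n-th coefficient carries
  \<open>moment \<mu> (Suc n)\<close>, the integral of \<open>t ^ Suc n\<close>. Exchanging sum and
  integral turns the series into the integral of t g'(t z), and each t z stays in the disc of radius
  |z|.\<close>

lemma norm_moment_diffs_le:
  fixes a :: "nat \<Rightarrow> complex"
  assumes a: "\<And>w. norm w < 1 \<Longrightarrow> (\<lambda>n. a n * w ^ n) sums g w"
    and B: "\<And>w. norm w \<le> norm z \<Longrightarrow> norm (deriv g w) \<le> B"
    and z: "norm z < 1"
  shows "norm (\<Sum>n. diffs (\<lambda>n. moment \<mu> n * a n) n * z ^ n) \<le> mass * B"
proof -
  have sa: "\<And>w. norm w < 1 \<Longrightarrow> summable (\<lambda>n. a n * w ^ n)"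
    using a sums_summable by blast
  have sd: "\<And>w. norm w < 1 \<Longrightarrow> summable (\<lambda>n. diffs a n * w ^ n)"
    by (rule termdiff_converges[where K = 1]) (auto intro: sa)
  have dg: "(\<lambda>n. diffs a n * w ^ n) sums deriv g w" if w: "norm w < 1" for w
  proof -
    have "((\<lambda>z. \<Sum>n. a n * z ^ n) has_field_derivative (\<Sum>n. diffs a n * w ^ n)) (at w)"
      by (rule termdiffs_strong'[where K = 1]) (auto intro: sa w)
    \<comment> \<open>The series agrees with \<open>g\<close> only on the unit disc; since this is
      an open neighbourhood of \<open>w\<close>, the derivative carries over to
      \<open>g\<close>.\<close>
    moreover have "(\<Sum>n. a n * z ^ n) = g z" if "z \<in> ball 0 1" for z
      using a[of z] that by (simp add: sums_iff)
    ultimately have "(g has_field_derivative (\<Sum>n. diffs a n * w ^ n)) (at w)"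
      using has_field_derivative_transform_within_open[of _ _ w "ball 0 1" g] w by force
    then show ?thesis using sd[OF w] DERIV_imp_deriv by (metis summable_sums)
  qed
  \<comment> \<open>\<open>u n t\<close> is the n-th term of t g'(t z), arranged so that
    \<open>t\<close> enters only through the power whose integral is a moment.\<close>
  define u where "u n t = complex_of_real (t ^ Suc n) * (diffs a n * z ^ n)" for n t
  have iu: "integrable \<mu> (u n)" for n
    unfolding u_def
    by (intro integrable_mult_left integrable_of_real) (rule integrable_power)
  have su: "u n t = t * (diffs a n * (t * z) ^ n)" for n t
    by (simp add: u_def power_mult_distrib)
  have tz: "norm (t * z) < 1" "norm (t * z) \<le> norm z" if "t \<in> space \<mu>" for t :: real
  proof -
    show "norm (t * z) \<le> norm z"
      using that by (simp add: space_eq norm_mult mult_left_le_one_le)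
    then show "norm (t * z) < 1" using z by simp
  qed
  \<comment> \<open>This majorant does not depend on \<open>t\<close>. It gives both conditions for
    the exchange: pointwise summability, and, as the measure is finite, summability of the
    integrals.\<close>
  have nsd: "summable (\<lambda>n. norm (diffs a n * z ^ n))"
    by (rule powser_summable_norm[where R = 1]) (auto intro: sd z)
  have nu: "norm (u n t) \<le> norm (diffs a n * z ^ n)" if "t \<in> space \<mu>" for n t
    using that unfolding u_def norm_mult norm_of_real
    by (intro mult_left_le_one_le) (auto simp: space_eq power_le_one mult_le_one abs_mult power_abs)
  have su_AE: "AE t in \<mu>. summable (\<lambda>n. norm (u n t))"
    using nu by (intro AE_I2 summable_comparison_test'[OF nsd]) auto
  have su_int: "summable (\<lambda>n. LINT t|\<mu>. norm (u n t))"
  proof (rule summable_comparison_test')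
    show "summable (\<lambda>n. mass * norm (diffs a n * z ^ n))"
      by (rule summable_mult[OF nsd])
    fix n
    have "(LINT t|\<mu>. norm (u n t)) \<le> (LINT t|\<mu>. norm (diffs a n * z ^ n))"
      by (rule integral_mono_AE) (auto intro!: AE_I2 nu integrable_norm iu)
    then show "norm (LINT t|\<mu>. norm (u n t)) \<le> mass * norm (diffs a n * z ^ n)"
      by simp
  qed
  have "(\<Sum>n. diffs (\<lambda>n. moment \<mu> n * a n) n * z ^ n) = (\<Sum>n. LINT t|\<mu>. u n t)"
  proof (rule suminf_cong)
    fix n
    have "(LINT t|\<mu>. u n t) = (LINT t|\<mu>. complex_of_real (t ^ Suc n)) * (diffs a n * z ^ n)"
      unfolding u_def by (rule integral_mult_left_zero)
    also have "(LINT t|\<mu>. complex_of_real (t ^ Suc n)) = moment \<mu> (Suc n)"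
      unfolding moment_def by (rule integral_of_real[OF integrable_power])
    finally show "diffs (\<lambda>n. moment \<mu> n * a n) n * z ^ n = (LINT t|\<mu>. u n t)"
      by (simp add: diffs_def)
  qed
  also have "\<dots> = (LINT t|\<mu>. (\<Sum>n. u n t))"
    by (rule integral_suminf[symmetric, OF iu su_AE su_int])
  also have "norm \<dots> \<le> (LINT t|\<mu>. B)"
  proof (rule Bochner_Integration.integral_norm_bound_integral)
    show "integrable \<mu> (\<lambda>t. \<Sum>n. u n t)"
      by (rule integrable_suminf[OF iu su_AE su_int])
    show "norm (\<Sum>n. u n t) \<le> B" if t: "t \<in> space \<mu>" for t
    proof -
      have "(\<lambda>n. u n t) sums (t * deriv g (t * z))"
        unfolding su by (rule sums_mult[OF dg[OF tz(1)[OF t]]])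
      then have "norm (\<Sum>n. u n t) = \<bar>t\<bar> * norm (deriv g (t * z))"
        by (simp add: sums_iff norm_mult)
      also have "\<dots> \<le> norm (deriv g (t * z))"
        using t by (intro mult_left_le_one_le) (auto simp: space_eq)
      also have "\<dots> \<le> B" by (rule B[OF tz(2)[OF t]])
      finally show ?thesis .
    qed
  qed simp
  finally show ?thesis by simp
qed

lemma has_field_derivative_cesaro_like:
  assumes "f holomorphic_on ball 0 1" "norm z < 1"
  shows "(cesaro_like \<mu> f has_field_derivative
    (\<Sum>n. diffs (\<lambda>n. moment \<mu> n * (\<Sum>k\<le>n. taylor_coeff f k)) n * z ^ n)) (at z)"
  unfolding cesaro_like_def[abs_def]
  by (rule termdiffs_strong'[where K = 1])
    (auto intro!: moment_powser_summable sums_summable[OF partial_sum_coeffs_sums] assms)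

lemma cesaro_like_0: "cesaro_like \<mu> f 0 = complex_of_real (moment \<mu> 0) * f 0"
proof -
  have "cesaro_like \<mu> f 0 = (\<Sum>n. (moment \<mu> n * (\<Sum>k\<le>n. taylor_coeff f k)) * 0 ^ n)"
    unfolding cesaro_like_def ..
  also have "\<dots> = complex_of_real (moment \<mu> 0) * f 0"
    unfolding powser_zero by (simp add: taylor_coeff_def)
  finally show ?thesis .
qed

lemma norm_deriv_cesaro_like_le:
  assumes f: "f holomorphic_on ball 0 1" and z: "norm z < 1"
    and B: "\<And>w. norm w \<le> norm z \<Longrightarrow> norm (deriv (\<lambda>w. f w / (1 - w)) w) \<le> B"
  shows "norm (deriv (cesaro_like \<mu> f) z) \<le> mass * B"
  using norm_moment_diffs_le[OF partial_sum_coeffs_sums[OF f] B z]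
    DERIV_imp_deriv[OF has_field_derivative_cesaro_like[OF f z]] by simp

end

section \<open>The Bloch seminorm and the inclusions between Bloch spaces\<close>

definition bloch_seminorm :: "real \<Rightarrow> (complex \<Rightarrow> complex) \<Rightarrow> real" where
  "bloch_seminorm \<alpha> f = (SUP z\<in>ball 0 1. (1 - (norm z)\<^sup>2) powr \<alpha> * norm (deriv f z))"

lemma bloch_norm_eq: "bloch_norm \<alpha> f = norm (f 0) + bloch_seminorm \<alpha> f"
  by (simp add: bloch_norm_def bloch_seminorm_def)

lemma bloch_seminorm_upper:
  assumes "f \<in> bloch_space \<alpha>" "norm z < 1"
  shows "(1 - (norm z)\<^sup>2) powr \<alpha> * norm (deriv f z) \<le> bloch_seminorm \<alpha> f"
  unfolding bloch_seminorm_def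
  using assms by (intro cSUP_upper) (auto simp: bloch_space_def)

lemma bloch_seminorm_nonneg:
  assumes "f \<in> bloch_space \<alpha>"
  shows "0 \<le> bloch_seminorm \<alpha> f"
  \<comment> \<open>At the origin the weight is 1, so the supremum is at least |f'(0)|.\<close>
  using bloch_seminorm_upper[OF assms, of 0] norm_ge_zero[of "deriv f 0"]
  by (simp del: norm_ge_zero)

lemma bloch_spaceI:
  assumes "f holomorphic_on ball 0 1"
    and "\<And>z. norm z < 1 \<Longrightarrow> (1 - (norm z)\<^sup>2) powr \<alpha> * norm (deriv f z) \<le> B"
  shows "f \<in> bloch_space \<alpha>" "bloch_seminorm \<alpha> f \<le> B"
  unfolding bloch_space_def bloch_seminorm_def
  using assms by (auto intro!: bdd_aboveI2 cSUP_least)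

text \<open>The base 1 - |z|^2 of the weight lies in (0,1], so raising the exponent lowers the
  weight.\<close>

lemma bloch_space_mono:
  assumes "\<alpha> \<le> \<alpha>'" "f \<in> bloch_space \<alpha>"
  shows "f \<in> bloch_space \<alpha>'" "bloch_norm \<alpha>' f \<le> bloch_norm \<alpha> f"
proof -
  have hol: "f holomorphic_on ball 0 1" using assms by (simp add: bloch_space_def)
  have "(1 - (norm z)\<^sup>2) powr \<alpha>' * norm (deriv f z) \<le> bloch_seminorm \<alpha> f"
    if z: "norm z < 1" for z
  proof -
    have "(norm z)\<^sup>2 < 1" using z by (simp add: power_less_one_iff)
    then have "(1 - (norm z)\<^sup>2) powr \<alpha>' \<le> (1 - (norm z)\<^sup>2) powr \<alpha>"
      by (intro powr_mono') (use assms in auto)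
    then have "(1 - (norm z)\<^sup>2) powr \<alpha>' * norm (deriv f z) \<le>
        (1 - (norm z)\<^sup>2) powr \<alpha> * norm (deriv f z)"
      by (rule mult_right_mono) simp
    also have "\<dots> \<le> bloch_seminorm \<alpha> f" by (rule bloch_seminorm_upper[OF assms(2) z])
    finally show ?thesis .
  qed
  from bloch_spaceI[OF hol this]
  show "f \<in> bloch_space \<alpha>'" "bloch_norm \<alpha>' f \<le> bloch_norm \<alpha> f"
    by (simp_all add: bloch_norm_eq)
qed

text \<open>The smaller source space embeds into the larger one with norm at most 1, so the operator
  bound restricts to it.\<close>

lemma bloch_bounded_mono_source:
  assumes "\<alpha> \<le> \<alpha>'" "bloch_bounded \<alpha>' \<beta> T"
  shows "bloch_bounded \<alpha> \<beta> T"
proof -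
  obtain C where sub: "T ` bloch_space \<alpha>' \<subseteq> bloch_space \<beta>"
    and C: "\<And>f. f \<in> bloch_space \<alpha>' \<Longrightarrow> bloch_norm \<beta> (T f) \<le> C * bloch_norm \<alpha>' f"
    using assms(2) unfolding bloch_bounded_def by blast
  \<comment> \<open>The definition of boundedness leaves the sign of \<open>C\<close> open; the
    absolute value makes multiplication by the constant monotone.\<close>
  have "bloch_norm \<beta> (T f) \<le> \<bar>C\<bar> * bloch_norm \<alpha> f" if f: "f \<in> bloch_space \<alpha>" for f
  proof -
    have f': "f \<in> bloch_space \<alpha>'" by (rule bloch_space_mono(1)[OF assms(1) f])
    have "0 \<le> bloch_norm \<alpha>' f"
      unfolding bloch_norm_eq using bloch_seminorm_nonneg[OF f'] by simp
    have "bloch_norm \<beta> (T f) \<le> C * bloch_norm \<alpha>' f" by (rule C[OF f'])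
    also have "\<dots> \<le> \<bar>C\<bar> * bloch_norm \<alpha>' f"
      using \<open>0 \<le> bloch_norm \<alpha>' f\<close> by (intro mult_right_mono) auto
    also have "\<dots> \<le> \<bar>C\<bar> * bloch_norm \<alpha> f"
      by (intro mult_left_mono bloch_space_mono(2)[OF assms(1) f]) simp
    finally show ?thesis .
  qed
  with sub bloch_space_mono(1)[OF assms(1)] show ?thesis
    unfolding bloch_bounded_def by blast
qed

section \<open>Pointwise growth of Bloch functions and of the quotient f(w) / (1 - w)\<close>

lemma norm_deriv_bloch_le:
  assumes "f \<in> bloch_space \<alpha>" "0 \<le> \<alpha>" "norm z < 1"
  shows "norm (deriv f z) \<le> bloch_seminorm \<alpha> f * (1 - norm z) powr - \<alpha>"
proof -
  \<comment> \<open>Hence 1 - |z| is at most 1 - |z|^2; the weaker weight in 1 - |z| has an explicit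
    primitive along a radius.\<close>
  have "(norm z)\<^sup>2 \<le> norm z"
    using assms(3) by (simp add: power2_eq_square mult_left_le_one_le)
  then have "(1 - norm z) powr \<alpha> \<le> (1 - (norm z)\<^sup>2) powr \<alpha>"
    using assms by (intro powr_mono2) auto
  then have "(1 - norm z) powr \<alpha> * norm (deriv f z) \<le> (1 - (norm z)\<^sup>2) powr \<alpha> * norm (deriv f z)"
    by (rule mult_right_mono) simp
  also have "\<dots> \<le> bloch_seminorm \<alpha> f" by (rule bloch_seminorm_upper[OF assms(1,3)])
  finally show ?thesis using assms(3) by (simp add: powr_minus field_simps)
qed

text \<open>A mean value inequality on the segment from 0 to \<open>z\<close> compares
  \<open>f\<close> with a primitive of the bound on f'. That primitive stays bounded for \<alpha> <
  1 and grows like (1 - |z|) to the power 1 - \<alpha> for \<alpha> > 1; the maximum in the exponent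
  covers both cases.\<close>

lemma bloch_growth:
  assumes f: "f \<in> bloch_space \<alpha>" and "0 \<le> \<alpha>" "\<alpha> \<noteq> 1" and z: "norm z < 1"
  shows "norm (f z) \<le> norm (f 0) +
    bloch_seminorm \<alpha> f / \<bar>\<alpha> - 1\<bar> * (1 - norm z) powr - max 0 (\<alpha> - 1)"
proof -
  define S r where "S = bloch_seminorm \<alpha> f" and "r = norm z"
  have S: "0 \<le> S" unfolding S_def by (rule bloch_seminorm_nonneg[OF f])
  have r: "0 \<le> r" "r < 1" using z by (auto simp: r_def)
  have hol: "f holomorphic_on ball 0 1" using f by (simp add: bloch_space_def)
  define h where "h x = f (complex_of_real x * z)" for x
  \<comment> \<open>\<open>\<phi>\<close> is a primitive of S r (1 - x r) to the power -\<alpha>,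
    which bounds |h'(x)|; it needs \<alpha> different from 1.\<close>
  define \<phi> where "\<phi> x = S / (\<alpha> - 1) * (1 - x * r) powr (1 - \<alpha>)" for x
  have xr: "x * r \<le> r" "x * r < 1" if "0 \<le> x" "x \<le> 1" for x
  proof -
    show "x * r \<le> r" using that r by (simp add: mult_left_le_one_le)
    then show "x * r < 1" using r by simp
  qed
  have xz: "norm (complex_of_real x * z) = x * r" if "0 \<le> x" for x
    using that by (simp add: norm_mult r_def)
  have dh: "(h has_vector_derivative z * deriv f (complex_of_real x * z)) (at x)"
    if "0 \<le> x" "x \<le> 1" for x
  proof -
    have "(f has_field_derivative deriv f (complex_of_real x * z)) (at (complex_of_real x * z))"
      using hol by (rule holomorphic_derivI) (use xr(2)[OF that] xz[OF that(1)] in auto)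
    moreover have "((\<lambda>x. complex_of_real x * z) has_vector_derivative z) (at x)"
      by (auto intro!: derivative_eq_intros)
    ultimately show ?thesis
      unfolding h_def[abs_def] using field_vector_diff_chain_at[unfolded o_def] by fastforce
  qed
  have d\<phi>: "(\<phi> has_vector_derivative S * r * (1 - x * r) powr - \<alpha>) (at x)"
    if "0 \<le> x" "x \<le> 1" for x
    unfolding \<phi>_def[abs_def] has_real_derivative_iff_has_vector_derivative[symmetric]
  proof -
    have "((\<lambda>x. (1 - x * r) powr (1 - \<alpha>)) has_real_derivative
        (1 - \<alpha>) * (1 - x * r) powr (1 - \<alpha> - 1) * - r) (at x)"
      using xr(2)[OF that] by (auto intro!: derivative_eq_intros)
    from DERIV_cmult[OF this, of "S / (\<alpha> - 1)"]
    have "((\<lambda>x. S / (\<alpha> - 1) * (1 - x * r) powr (1 - \<alpha>)) has_real_derivative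
        S / (\<alpha> - 1) * ((1 - \<alpha>) * (1 - x * r) powr (1 - \<alpha> - 1) * - r)) (at x)" .
    also have "S / (\<alpha> - 1) * ((1 - \<alpha>) * (1 - x * r) powr (1 - \<alpha> - 1) * - r) =
        S * r * (1 - x * r) powr - \<alpha> * ((\<alpha> - 1) / (\<alpha> - 1))"
    proof -
      \<comment> \<open>With \<open>a / a\<close> left standing the identity holds even for a = 0;
        the quotient is cancelled only at the end, from \<alpha> \<noteq> 1.\<close>
      have "S / a * ((- a) * q * - r) = S * r * q * (a / a)" for a q
        by simp
      from this[of "\<alpha> - 1" "(1 - x * r) powr - \<alpha>"] show ?thesis by simp
    qed
    finally show "((\<lambda>x. S / (\<alpha> - 1) * (1 - x * r) powr (1 - \<alpha>)) has_real_derivative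
        S * r * (1 - x * r) powr - \<alpha>) (at x)"
      using \<open>\<alpha> \<noteq> 1\<close> by simp
  qed
  have "norm (h 1 - h 0) \<le> \<phi> 1 - \<phi> 0"
  proof (rule differentiable_bound_general[OF zero_less_one])
    show "continuous_on {0..1} h" "continuous_on {0..1} \<phi>"
      using dh d\<phi> by (auto intro!: continuous_at_imp_continuous_on has_vector_derivative_continuous)
    fix x :: real assume x: "0 < x" "x < 1"
    show "(h has_vector_derivative z * deriv f (complex_of_real x * z)) (at x)"
      "(\<phi> has_vector_derivative S * r * (1 - x * r) powr - \<alpha>) (at x)"
      using dh d\<phi> x by auto
    have "norm (deriv f (complex_of_real x * z)) \<le> S * (1 - x * r) powr - \<alpha>"
      using norm_deriv_bloch_le[OF f \<open>0 \<le> \<alpha>\<close>, of "complex_of_real x * z"] xz[of x] xr(2)[of x] x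
      by (simp add: S_def)
    then show "norm (z * deriv f (complex_of_real x * z)) \<le> S * r * (1 - x * r) powr - \<alpha>"
      using mult_left_mono[OF _ r(1)] by (fastforce simp: norm_mult r_def[symmetric] mult_ac)
  qed
  \<comment> \<open>For \<alpha> < 1 the subtracted power of 1 - r is dropped, leaving a constant.
    For \<alpha> > 1 it is \<open>\<phi> 0\<close> that is nonnegative and dropped.\<close>
  moreover have "\<phi> 1 - \<phi> 0 \<le> S / \<bar>\<alpha> - 1\<bar> * (1 - r) powr - max 0 (\<alpha> - 1)"
  proof (cases "\<alpha> < 1")
    case True
    have "\<phi> 1 - \<phi> 0 = S / (1 - \<alpha>) * (1 - (1 - r) powr (1 - \<alpha>))"
    proof -
      have "S / (\<alpha> - 1) = - (S / (1 - \<alpha>))"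
        by (metis minus_diff_eq minus_divide_right)
      then show ?thesis by (simp add: \<phi>_def algebra_simps)
    qed
    also have "\<dots> \<le> S / (1 - \<alpha>) * 1"
      using True S by (intro mult_left_mono) auto
    finally show ?thesis using True r by (simp add: max_def)
  next
    case False
    then have "\<alpha> > 1" using \<open>\<alpha> \<noteq> 1\<close> by simp
    then have "0 \<le> \<phi> 0" using S by (simp add: \<phi>_def)
    then show ?thesis using \<open>\<alpha> > 1\<close> by (simp add: \<phi>_def max_def)
  qed
  ultimately have "norm (f z - f 0) \<le> S / \<bar>\<alpha> - 1\<bar> * (1 - r) powr - max 0 (\<alpha> - 1)"
    by (simp add: h_def)
  then show ?thesis
    using norm_triangle_sub[of "f z" "f 0"] unfolding S_def r_def by linarith
qed

text \<open>The quotient rule and |1 - w| \<ge> 1 - |w| produce the exponents \<alpha> + 1, 2 and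
  max 0 (\<alpha> - 1) + 2, the last being the larger of the other two. The bound is in
  \<open>r\<close> rather than |w| so that one constant serves the whole disc |w| \<le> r.\<close>

lemma norm_deriv_bloch_quotient_le:
  assumes f: "f \<in> bloch_space \<alpha>" and \<alpha>: "0 \<le> \<alpha>" "\<alpha> \<noteq> 1"
    and \<beta>: "2 \<le> \<beta>" "\<alpha> + 1 \<le> \<beta>" and wr: "norm w \<le> r" "r < 1"
  shows "norm (deriv (\<lambda>w. f w / (1 - w)) w) \<le>
    (1 + 1 / \<bar>\<alpha> - 1\<bar>) * bloch_norm \<alpha> f * (1 - r) powr - \<beta>"
proof -
  define S s \<gamma> where "S = bloch_seminorm \<alpha> f" and "s = 1 - norm w" and "\<gamma> = max 0 (\<alpha> - 1)"
  have S: "0 \<le> S" unfolding S_def by (rule bloch_seminorm_nonneg[OF f])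
  have w: "norm w < 1" using wr by simp
  have s: "0 < s" "s \<le> 1" using w by (auto simp: s_def)
  have sw: "s \<le> norm (1 - w)"
    using norm_triangle_ineq2[of 1 w] by (simp add: s_def)
  have w1: "1 - w \<noteq> 0" using sw s by auto
  have hol: "f holomorphic_on ball 0 1" using f by (simp add: bloch_space_def)
  have "(f has_field_derivative deriv f w) (at w)"
    using hol by (rule holomorphic_derivI) (use w in auto)
  then have "((\<lambda>w. f w / (1 - w)) has_field_derivative
      deriv f w / (1 - w) + f w / (1 - w)\<^sup>2) (at w)"
    using w1 by (auto intro!: derivative_eq_intros simp: add_divide_distrib power2_eq_square)
  then have "deriv (\<lambda>w. f w / (1 - w)) w = deriv f w / (1 - w) + f w / (1 - w)\<^sup>2"
    by (rule DERIV_imp_deriv)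
  then have "norm (deriv (\<lambda>w. f w / (1 - w)) w) \<le>
      norm (deriv f w) / norm (1 - w) + norm (f w) / (norm (1 - w))\<^sup>2"
    using norm_triangle_ineq[of "deriv f w / (1 - w)" "f w / (1 - w)\<^sup>2"]
    by (simp add: norm_divide norm_power)
  also have "\<dots> \<le> norm (deriv f w) / s + norm (f w) / s\<^sup>2"
    using s sw by (intro add_mono divide_left_mono power_mono mult_pos_pos zero_less_power) auto
  also have "\<dots> \<le> S * s powr - \<alpha> / s + (norm (f 0) + S / \<bar>\<alpha> - 1\<bar> * s powr - \<gamma>) / s\<^sup>2"
    using norm_deriv_bloch_le[OF f \<alpha>(1) w] bloch_growth[OF f \<alpha> w] s
    unfolding S_def s_def \<gamma>_def by (intro add_mono divide_right_mono) auto
  also have "\<dots> = S * s powr - (\<alpha> + 1) + norm (f 0) * s powr - 2 +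
      S / \<bar>\<alpha> - 1\<bar> * s powr - (\<gamma> + 2)"
  proof -
    have "s powr - (x + 1) = s powr - x / s" "s powr - (x + 2) = s powr - x / s\<^sup>2"
      "s powr - 2 = 1 / s\<^sup>2" for x
      unfolding powr_minus powr_add using s by (simp_all add: divide_simps)
    then show ?thesis by (simp only:) (simp add: add_divide_distrib)
  qed
  \<comment> \<open>Since 0 < s \<le> 1, each exponent may be lowered to -\<beta>.\<close>
  also have "\<dots> \<le> S * s powr - \<beta> + norm (f 0) * s powr - \<beta> + S / \<bar>\<alpha> - 1\<bar> * s powr - \<beta>"
    using s S \<beta> by (intro add_mono mult_left_mono powr_mono') (auto simp: \<gamma>_def)
  \<comment> \<open>The two sides differ by the nonnegative cross term with
    \<open>norm (f 0) / \<bar>\<alpha> - 1\<bar>\<close>.\<close>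
  also have "\<dots> \<le> (1 + 1 / \<bar>\<alpha> - 1\<bar>) * (norm (f 0) + S) * s powr - \<beta>"
    by (simp add: algebra_simps add_divide_distrib)
  also have "\<dots> \<le> (1 + 1 / \<bar>\<alpha> - 1\<bar>) * (norm (f 0) + S) * (1 - r) powr - \<beta>"
    using S wr \<beta> by (intro mult_left_mono powr_mono2') (auto simp: s_def)
  finally show ?thesis by (simp add: bloch_norm_eq S_def)
qed

section \<open>Boundedness of the operator\<close>

lemma (in unit_interval_measure) bloch_bounded_cesaro_like:
  assumes \<alpha>: "0 \<le> \<alpha>" "\<alpha> \<noteq> 1" and \<beta>: "2 \<le> \<beta>" "\<alpha> + 1 \<le> \<beta>"
  shows "bloch_bounded \<alpha> \<beta> (cesaro_like \<mu>)"
proof -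
  \<comment> \<open>The factor \<open>2 powr \<beta>\<close> pays for replacing 1 - |z|^2 by 2 (1 -
    |z|), \<open>mass\<close> comes from the integral, and the rest from the quotient
    estimate.\<close>
  define K where "K = 2 powr \<beta> * mass * (1 + 1 / \<bar>\<alpha> - 1\<bar>)"
  have *: "cesaro_like \<mu> f \<in> bloch_space \<beta> \<and>
      bloch_norm \<beta> (cesaro_like \<mu> f) \<le> (mass + K) * bloch_norm \<alpha> f"
    if f: "f \<in> bloch_space \<alpha>" for f
  proof -
    have hol: "f holomorphic_on ball 0 1" using f by (simp add: bloch_space_def)
    define N where "N = (1 + 1 / \<bar>\<alpha> - 1\<bar>) * bloch_norm \<alpha> f"
    have N0: "norm (f 0) \<le> bloch_norm \<alpha> f" "0 \<le> bloch_norm \<alpha> f"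
      using bloch_seminorm_nonneg[OF f] by (auto simp: bloch_norm_eq)
    have holT: "cesaro_like \<mu> f holomorphic_on ball 0 1"
      unfolding holomorphic_on_open[OF open_ball]
      using has_field_derivative_cesaro_like[OF hol] by (metis mem_ball_0)
    have "(1 - (norm z)\<^sup>2) powr \<beta> * norm (deriv (cesaro_like \<mu> f) z) \<le> K * bloch_norm \<alpha> f"
      if z: "norm z < 1" for z
    proof -
      have "norm (deriv (cesaro_like \<mu> f) z) \<le> mass * (N * (1 - norm z) powr - \<beta>)"
        unfolding N_def
        \<comment> \<open>The radius \<open>r\<close> of the quotient estimate is taken to be
          \<open>norm z\<close>.\<close>
        by (intro norm_deriv_cesaro_like_le norm_deriv_bloch_quotient_le hol z f \<alpha> \<beta>)
      moreover have "(1 - (norm z)\<^sup>2) powr \<beta> \<le> (2 * (1 - norm z)) powr \<beta>"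
      proof (rule powr_mono2)
        \<comment> \<open>The square is exactly the difference of the two sides of the inequality
          below.\<close>
        have "0 \<le> (1 - norm z)\<^sup>2" by simp
        then show "1 - (norm z)\<^sup>2 \<le> 2 * (1 - norm z)"
          by (simp add: power2_eq_square algebra_simps)
      qed (use z \<beta> in \<open>auto simp: power_le_one\<close>)
      ultimately have "(1 - (norm z)\<^sup>2) powr \<beta> * norm (deriv (cesaro_like \<mu> f) z) \<le>
          (2 * (1 - norm z)) powr \<beta> * (mass * (N * (1 - norm z) powr - \<beta>))"
        by (intro mult_mono) auto
      also have "\<dots> = K * bloch_norm \<alpha> f"
        using z unfolding K_def N_def
        by (subst powr_mult) (auto simp: powr_minus)
      finally show ?thesis .
    qed
    note bloch_spaceI[OF holT this]
    moreover have "norm (cesaro_like \<mu> f 0) \<le> mass * bloch_norm \<alpha> f"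
    proof -
      have "norm (cesaro_like \<mu> f 0) = moment \<mu> 0 * norm (f 0)"
        using moment_nonneg[of 0] by (simp add: cesaro_like_0 norm_mult)
      then show ?thesis
        using N0 moment_nonneg[of 0] moment_le[of 0] by (simp add: mult_mono)
    qed
    ultimately show ?thesis by (simp add: bloch_norm_eq algebra_simps)
  qed
  then show ?thesis unfolding bloch_bounded_def by blast
qed

theorem theorem3p4:
  fixes \<mu> :: "real measure" and \<alpha> \<beta> :: real
  assumes "finite_measure \<mu>"
    and "sets \<mu> = sets (restrict_space borel {0..<1})"
    and "(\<alpha> = 1 \<and> \<beta> > 2) \<or> (0 < \<alpha> \<and> \<alpha> < 1 \<and> \<beta> \<ge> 2) \<or> (\<alpha> > 1 \<and> \<beta> \<ge> \<alpha> + 1)"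
  shows "bloch_bounded \<alpha> \<beta> (cesaro_like \<mu>)"
proof -
  interpret unit_interval_measure \<mu>
    using assms(1,2) by (simp add: unit_interval_measure_def unit_interval_measure_axioms_def)
  show ?thesis
  proof (cases "\<alpha> = 1")
    case True
    then have "\<beta> > 2" using assms(3) by auto
    \<comment> \<open>The source exponent \<beta> - 1 meets the condition relating it to \<beta>
      with equality, and \<beta> > 2 puts it strictly above 1.\<close>
    then have "bloch_bounded (\<beta> - 1) \<beta> (cesaro_like \<mu>)"
      by (intro bloch_bounded_cesaro_like) auto
    then show ?thesis
      using True \<open>\<beta> > 2\<close> by (intro bloch_bounded_mono_source[of \<alpha> "\<beta> - 1"]) auto
  next
    case False
    \<comment> \<open>Each remaining case implies both lower bounds on \<beta>: \<alpha> + 1 < 2 if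
      \<alpha> < 1, and 2 < \<alpha> + 1 if \<alpha> > 1.\<close>
    then show ?thesis using assms(3) by (intro bloch_bounded_cesaro_like) auto
  qed
qed

end
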